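(* Let $\tau=t_1<t_2<\dots<t_N=\tau'$. Let $p^\nu_{n|n+1}(x_{t_n}|x_{t_{n+1}})$, $n=1,\dots,N-1$, be the (discretised, possibly imperfect) denoising transition densities of a diffusion model, let $p_{t_N}$ be the density of the model sample at time $t_N$, and let $p_{t_n}$ be the density at time $t_n$ of the Markov chain started from $p_{t_N}$ at $t_N$ and evolved down with the kernels $p^\nu_{n|n+1}$. Let $r_\tau,r_{\tau'}:\mathbb{R}^d\to\mathbb{R}$ and let the intermediate targets be the densities $q_\tau\propto p_{t_1}\exp(r_\tau)$ and $q_{\tau'}\propto p_{t_N}\exp(r_{\tau'})$. Let $p^a_{n|n+1}(x_{t_n}|x_{t_{n+1}})$ be arbitrary (positive) sampling transition densities. Let the proposal be the path density $$q_{\tau'}(x_{t_N})\prod_{n=1}^{N-1}p^a_{n|n+1}(x_{t_n}|x_{t_{n+1}}),$$ and let the target be the path density $q_\tau(x_{t_1})\,p_{2:N|1}(x_{t_{2:N}}|x_{t_1})$, where $p_{2:N|1}$ is the conditional density of $X_{t_{2:N}}$ given $X_{t_1}$ under the denoising chain. Then the importance weight $w_{[\tau,\tau']}$ (target path density divided by proposal path density) is given exactly, up to a multiplicative constant independent of the path, by $$w_{[\tau,\tau']}\propto\frac{\exp(r_\tau(X_{t_1}))}{\exp(r_{\tau'}(X_{t_N}))}\;\frac{\prod_{n=1}^{N-1}p^\nu_{n|n+1}(X_{t_n}|X_{t_{n+1}})}{\prod_{n=1}^{N-1}p^a_{n|n+1}(X_{t_n}|X_{t_{n+1}})}.$$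
   Context: The denoising chain has joint density $p_{t_N}(x_{t_N})\prod_{n=1}^{N-1}p^\nu_{n|n+1}(x_{t_n}|x_{t_{n+1}})$, and $p_{2:N|1}$ is the corresponding Bayesian posterior of $X_{t_{2:N}}=(X_{t_2},\dots,X_{t_N})$ given $X_{t_1}$. No assumption is made that the denoising kernels are the exact time-reversal of a noising process, nor that the discretisation is exact: $p_t$ is by definition the law of samples produced by the imperfect, discretised model. All densities are with respect to Lebesgue measure on $\mathbb{R}^d$ and assumed positive. *)

theory Defs
  imports "HOL-Analysis.Analysis"
begin

definition proportional :: "('a \<Rightarrow> real) \<Rightarrow> ('a \<Rightarrow> real) \<Rightarrow> bool"  (infix "\<propto>" 50)
  where "f \<propto> g \<longleftrightarrow> (\<exists>c>0. \<forall>x. f x = c * g x)"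

definition pos_density :: "(real ^ 'd \<Rightarrow> real) \<Rightarrow> bool"
  where "pos_density f \<longleftrightarrow>
    f \<in> borel_measurable lborel \<and> (\<forall>x. f x > 0) \<and> (\<integral>\<^sup>+x. ennreal (f x) \<partial>lborel) = 1"

text \<open>For a transition density, \<open>k x y\<close> is the density of moving to \<open>x\<close> given the current
  state \<open>y\<close>, usually written \<open>k(x | y)\<close>.\<close>

definition pos_transition_density :: "(real ^ 'd \<Rightarrow> real ^ 'd \<Rightarrow> real) \<Rightarrow> bool"
  where "pos_transition_density k \<longleftrightarrow>
    (\<lambda>(x, y). k x y) \<in> borel_measurable (lborel \<Otimes>\<^sub>M lborel) \<and> (\<forall>y. pos_density (\<lambda>x. k x y))"

text \<open>A path is a function on indices of which only the values at \<open>1, \<dots>, N\<close> matter. The chain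
  runs downwards: it starts at index \<open>N\<close> with density \<open>f\<close>, and \<open>k n\<close> moves it from index
  \<open>n + 1\<close> to index \<open>n\<close>.\<close>

definition path_density ::
    "nat \<Rightarrow> (real ^ 'd \<Rightarrow> real) \<Rightarrow> (nat \<Rightarrow> real ^ 'd \<Rightarrow> real ^ 'd \<Rightarrow> real) \<Rightarrow> (nat \<Rightarrow> real ^ 'd) \<Rightarrow> real"
  where "path_density N f k x = f (x N) * (\<Prod>n=1..<N. k n (x n) (x (Suc n)))"

text \<open>Conditional density of the coordinates \<open>2, \<dots>, N\<close> of the chain, at \<open>z\<close>, given that
  coordinate 1 equals \<open>y\<close>: the joint density divided by its integral over the coordinates
  \<open>2, \<dots>, N\<close>. The value \<open>z 1\<close> is irrelevant.\<close>

definition posterior_density ::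
    "nat \<Rightarrow> (real ^ 'd \<Rightarrow> real) \<Rightarrow> (nat \<Rightarrow> real ^ 'd \<Rightarrow> real ^ 'd \<Rightarrow> real) \<Rightarrow>
      (nat \<Rightarrow> real ^ 'd) \<Rightarrow> real ^ 'd \<Rightarrow> real"
  where "posterior_density N f k z y =
    path_density N f k (z(1 := y)) /
    (\<integral>z'. path_density N f k (z'(1 := y)) \<partial>(PiM {2..N} (\<lambda>_. lborel)))"

definition importance_weight ::
    "((nat \<Rightarrow> real ^ 'd) \<Rightarrow> real) \<Rightarrow> ((nat \<Rightarrow> real ^ 'd) \<Rightarrow> real) \<Rightarrow> (nat \<Rightarrow> real ^ 'd) \<Rightarrow> real"
  where "importance_weight target proposal x = target x / proposal x"

end

theory Submission
  imports Defs
begin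

text \<open>Integrating out the coordinates \<open>2, \<dots>, N\<close> of the chain one at a time, from the top
  downwards, collapses its path density to the marginal \<open>p\<^bsub>t 1\<^esub>\<close>. So the posterior is the path
  density over \<open>p\<^bsub>t 1\<^esub>(x\<^sub>1)\<close>: this factor cancels against the one in \<open>q\<^bsub>\<tau>\<^esub>\<close>, and the initial factor
  \<open>p\<^bsub>t N\<^esub>(x\<^sub>N)\<close> cancels against the one in \<open>q\<^bsub>\<tau>'\<^esub>\<close>.\<close>

lemma measurable_chain_density:
  fixes k :: "nat \<Rightarrow> 'a::euclidean_space \<Rightarrow> 'a \<Rightarrow> real"
  assumes f: "f \<in> borel_measurable lborel"
    and k: "\<And>n. n \<in> {m..<N} \<Longrightarrow> (\<lambda>(x, y). k n x y) \<in> borel_measurable (lborel \<Otimes>\<^sub>M lborel)"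
    and "m \<le> N"
  shows "(\<lambda>x. f (x N) * (\<Prod>n=m..<N. k n (x n) (x (Suc n))))
    \<in> borel_measurable (PiM {m..N} (\<lambda>_. lborel))"
proof (intro borel_measurable_times borel_measurable_prod)
  show "(\<lambda>x. f (x N)) \<in> borel_measurable (PiM {m..N} (\<lambda>_. lborel))"
    using \<open>m \<le> N\<close> by (intro measurable_compose[OF _ f] measurable_component_singleton) simp
next
  fix n assume n: "n \<in> {m..<N}"
  have "(\<lambda>x. (x n, x (Suc n))) \<in> PiM {m..N} (\<lambda>_. lborel) \<rightarrow>\<^sub>M lborel \<Otimes>\<^sub>M (lborel :: 'a measure)"
    using n by (intro measurable_Pair measurable_component_singleton) auto
  from measurable_compose[OF this k[OF n]]
  show "(\<lambda>x. k n (x n) (x (Suc n))) \<in> borel_measurable (PiM {m..N} (\<lambda>_. lborel))"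
    by simp
qed

text \<open>Setting coordinate \<open>m\<close> to \<open>y\<close> maps the product over
  \<open>{Suc m..N}\<close> into the product over \<open>{m..N}\<close>. This is the form in which
  the chain density is integrated with its lowest coordinate held fixed.\<close>

lemma measurable_chain_density_upd:
  fixes k :: "nat \<Rightarrow> 'a::euclidean_space \<Rightarrow> 'a \<Rightarrow> real"
  assumes "f \<in> borel_measurable lborel"
    and "\<And>n. n \<in> {m..<N} \<Longrightarrow> (\<lambda>(x, y). k n x y) \<in> borel_measurable (lborel \<Otimes>\<^sub>M lborel)"
    and "m \<le> N"
  shows "(\<lambda>z. f ((z(m := y)) N) * (\<Prod>n=m..<N. k n ((z(m := y)) n) ((z(m := y)) (Suc n))))
    \<in> borel_measurable (PiM {Suc m..N} (\<lambda>_. lborel))"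
proof -
  have "(\<lambda>z. z(m := y)) \<in> PiM {Suc m..N} (\<lambda>_. lborel) \<rightarrow>\<^sub>M PiM {m..N} (\<lambda>_. lborel)"
    using \<open>m \<le> N\<close> by (intro measurable_fun_upd[where J = "{Suc m..N}"]) auto
  from measurable_compose[OF this measurable_chain_density[OF assms]]
  show ?thesis .
qed

text \<open>Induction on \<open>m\<close> downwards from \<open>N\<close>: the factor
  \<open>k m y w\<close> is constant in the coordinates above \<open>Suc m\<close>, these integrate
  to \<open>g (Suc m) w\<close> by the induction hypothesis, and the recursion for \<open>g\<close>
  absorbs the remaining integral over \<open>w\<close>. With values in \<open>ennreal\<close>,
  Tonelli applies without integrability conditions.\<close>

lemma nn_integral_chain_density:
  fixes k :: "nat \<Rightarrow> 'a::euclidean_space \<Rightarrow> 'a \<Rightarrow> real"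
  assumes f: "g N \<in> borel_measurable lborel"
    and k: "\<And>n. n \<in> {m..<N} \<Longrightarrow> (\<lambda>(x, y). k n x y) \<in> borel_measurable (lborel \<Otimes>\<^sub>M lborel)"
    and nonneg: "\<And>n x y. n \<in> {m..<N} \<Longrightarrow> k n x y \<ge> 0"
    and g: "\<And>n x. n \<in> {m..<N} \<Longrightarrow>
      ennreal (g n x) = (\<integral>\<^sup>+y. ennreal (k n x y) * ennreal (g (Suc n) y) \<partial>lborel)"
    and "m \<le> N"
  shows "(\<integral>\<^sup>+z. ennreal (g N ((z(m := y)) N) *
      (\<Prod>n=m..<N. k n ((z(m := y)) n) ((z(m := y)) (Suc n)))) \<partial>PiM {Suc m..N} (\<lambda>_. lborel))
    = ennreal (g m y)"
  using \<open>m \<le> N\<close> k nonneg g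
proof (induction m arbitrary: y rule: inc_induct)
  case base
  \<comment> \<open>For \<open>m = N\<close> the index set and the product of kernels are empty, and
    the product measure is a unit mass at a single point.\<close>
  show ?case by (simp add: PiM_empty nn_integral_count_space_finite)
next
  case (step m)
  interpret product_sigma_finite "\<lambda>_::nat. lborel :: 'a measure"
    by (intro product_sigma_finite.intro sigma_finite_lborel)
  define G where "G i x = g N (x N) * (\<Prod>n=i..<N. k n (x n) (x (Suc n)))" for i x
  have GSuc: "G m x = k m (x m) (x (Suc m)) * G (Suc m) x" for x
    using step.hyps by (simp add: G_def prod.atLeast_Suc_lessThan mult_ac)
  \<comment> \<open>\<open>G (Suc m)\<close> reads only coordinates from \<open>Suc m\<close> on, so
    overwriting coordinate \<open>m\<close> does not affect it.\<close>
  have G_upd: "G (Suc m) (z(m := y)) = G (Suc m) z" for z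
    using step.hyps unfolding G_def
    by (intro arg_cong2[where f = "(*)"] prod.cong) auto
  have meas: "(\<lambda>z. G m (z(m := y))) \<in> borel_measurable (PiM {Suc m..N} (\<lambda>_. lborel))"
    unfolding G_def using step.hyps step.prems(1)
    by (intro measurable_chain_density_upd f) auto
  have meas': "(\<lambda>z. G (Suc m) (z(Suc m := w)))
      \<in> borel_measurable (PiM {Suc (Suc m)..N} (\<lambda>_. lborel))" for w
    unfolding G_def using step.hyps step.prems(1)
    by (intro measurable_chain_density_upd f) auto
  \<comment> \<open>The fixed value is now the integration variable \<open>w\<close>, which is why
    the induction generalises over \<open>y\<close>.\<close>
  have IH: "(\<integral>\<^sup>+z. ennreal (G (Suc m) (z(Suc m := w))) \<partial>PiM {Suc (Suc m)..N} (\<lambda>_. lborel))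
      = ennreal (g (Suc m) w)" for w
    unfolding G_def using step.prems by (intro step.IH) auto
  \<comment> \<open>Tonelli splits off coordinate \<open>Suc m\<close> as the outermost
    integral.\<close>
  have "insert (Suc m) {Suc (Suc m)..N} = {Suc m..N}"
    using step.hyps by auto
  then have "(\<integral>\<^sup>+z. ennreal (G m (z(m := y))) \<partial>PiM {Suc m..N} (\<lambda>_. lborel))
    = (\<integral>\<^sup>+w. \<integral>\<^sup>+z. ennreal (G m (z(Suc m := w, m := y))) \<partial>PiM {Suc (Suc m)..N} (\<lambda>_. lborel) \<partial>lborel)"
    using product_nn_integral_insert_rev[of "{Suc (Suc m)..N}" "Suc m"
        "\<lambda>z. ennreal (G m (z(m := y)))"] meas by simp
  also have "\<dots> = (\<integral>\<^sup>+w. ennreal (k m y w) * ennreal (g (Suc m) w) \<partial>lborel)"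
  proof (intro nn_integral_cong)
    fix w
    have "ennreal (G m (z(Suc m := w, m := y)))
        = ennreal (k m y w) * ennreal (G (Suc m) (z(Suc m := w)))" for z
      using step.hyps step.prems(2)[of m y w] by (simp add: GSuc G_upd ennreal_mult')
    then show "(\<integral>\<^sup>+z. ennreal (G m (z(Suc m := w, m := y))) \<partial>PiM {Suc (Suc m)..N} (\<lambda>_. lborel))
        = ennreal (k m y w) * ennreal (g (Suc m) w)"
      using meas'[of w] by (simp add: nn_integral_cmult IH)
  qed
  also have "\<dots> = ennreal (g m y)"
    using step.hyps by (intro step.prems(3)[symmetric]) auto
  finally show ?case unfolding G_def .
qed

text \<open>This evaluates the denominator of \<open>posterior_density\<close>. Both it and the
  recursion for the marginals are Bochner integrals; positivity allows the passage to
  \<open>ennreal\<close> and back.\<close>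

lemma integral_path_density:
  assumes "N \<ge> 1"
    and k: "\<And>n. n \<in> {1..<N} \<Longrightarrow> pos_transition_density (k n)"
    and g: "\<And>n. n \<in> {1..N} \<Longrightarrow> pos_density (g n)"
    and g_eq: "\<And>n x. n \<in> {1..<N} \<Longrightarrow> g n x = (\<integral>y. k n x y * g (Suc n) y \<partial>lborel)"
  shows "(\<integral>z. path_density N (g N) k (z(1 := y)) \<partial>PiM {2..N} (\<lambda>_. lborel)) = g 1 y"
proof -
  have kpos: "k n x y > 0" if "n \<in> {1..<N}" for n x y
    using k[OF that] by (simp add: pos_transition_density_def pos_density_def)
  have kmeas: "(\<lambda>(x, y). k n x y) \<in> borel_measurable (lborel \<Otimes>\<^sub>M lborel)" if "n \<in> {1..<N}" for n
    using k[OF that] by (simp add: pos_transition_density_def)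
  have gpos: "g n x > 0" if "n \<in> {1..N}" for n x
    using g[OF that] by (simp add: pos_density_def)
  have gmeas: "g N \<in> borel_measurable lborel"
    using g[of N] \<open>N \<ge> 1\<close> by (simp add: pos_density_def)
  have nn_eq: "ennreal (g n x) = (\<integral>\<^sup>+y. ennreal (k n x y) * ennreal (g (Suc n) y) \<partial>lborel)"
    if n: "n \<in> {1..<N}" for n x
  proof -
    \<comment> \<open>The Bochner integral of a non-integrable function is \<open>0\<close>, but \<open>g n x\<close> is positive.\<close>
    have "integrable lborel (\<lambda>y. k n x y * g (Suc n) y)"
      using not_integrable_integral_eq g_eq[OF n, of x] gpos[of n x] n by fastforce
    then have "(\<integral>\<^sup>+y. ennreal (k n x y * g (Suc n) y) \<partial>lborel) = ennreal (g n x)"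
      using n kpos gpos by (subst nn_integral_eq_integral) (auto simp: g_eq intro!: less_imp_le)
    then show ?thesis
      using n kpos[OF n, of x] by (simp add: ennreal_mult' less_imp_le)
  qed
  have "(\<integral>\<^sup>+z. ennreal (path_density N (g N) k (z(1 := y))) \<partial>PiM {2..N} (\<lambda>_. lborel)) = ennreal (g 1 y)"
    unfolding path_density_def
    using nn_integral_chain_density[of g N 1 k y, OF gmeas kmeas less_imp_le[OF kpos] nn_eq \<open>N \<ge> 1\<close>]
    by (simp only: Suc_1)
  moreover have "(\<lambda>z. path_density N (g N) k (z(1 := y))) \<in> borel_measurable (PiM {2..N} (\<lambda>_. lborel))"
    using measurable_chain_density_upd[of "g N" 1 N k y, OF gmeas kmeas \<open>N \<ge> 1\<close>]
    unfolding path_density_def by (simp only: Suc_1)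
  moreover have "path_density N (g N) k x \<ge> 0" for x
    unfolding path_density_def using \<open>N \<ge> 1\<close> kpos gpos[of N]
    by (intro mult_nonneg_nonneg prod_nonneg) (auto intro: less_imp_le)
  \<comment> \<open>For a nonnegative measurable integrand the Bochner integral is the real value of
    the \<open>ennreal\<close> integral, here the finite number \<open>g 1 y\<close>.\<close>
  ultimately show ?thesis
    using gpos[of 1 y] \<open>N \<ge> 1\<close> by (simp add: integral_eq_nn_integral)
qed

theorem proposition2p2:
  fixes N :: nat
    and t :: "nat \<Rightarrow> real"
    and \<tau> \<tau>' :: real
    and p_nu p_a :: "nat \<Rightarrow> real ^ 'd \<Rightarrow> real ^ 'd \<Rightarrow> real"
    and p q r :: "real \<Rightarrow> real ^ 'd \<Rightarrow> real"
  assumes "N \<ge> 2"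
    and "strict_mono_on {1..N} t" and "\<tau> = t 1" and "\<tau>' = t N"
    and "\<And>n. n \<in> {1..<N} \<Longrightarrow> pos_transition_density (p_nu n)"
    and "\<And>n. n \<in> {1..<N} \<Longrightarrow> pos_transition_density (p_a n)"
    and "\<And>n. n \<in> {1..N} \<Longrightarrow> pos_density (p (t n))"
    and "\<And>n x. n \<in> {1..<N} \<Longrightarrow> p (t n) x = (\<integral>y. p_nu n x y * p (t (Suc n)) y \<partial>lborel)"
    and "pos_density (q \<tau>)" and "q \<tau> \<propto> (\<lambda>x. p (t 1) x * exp (r \<tau> x))"
    and "pos_density (q \<tau>')" and "q \<tau>' \<propto> (\<lambda>x. p (t N) x * exp (r \<tau>' x))"
  shows "importance_weight
           (\<lambda>X. q \<tau> (X 1) * posterior_density N (p (t N)) p_nu X (X 1))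
           (path_density N (q \<tau>') p_a)
         \<propto> (\<lambda>X. exp (r \<tau> (X 1)) / exp (r \<tau>' (X N)) *
                 ((\<Prod>n=1..<N. p_nu n (X n) (X (Suc n))) / (\<Prod>n=1..<N. p_a n (X n) (X (Suc n)))))"
proof -
  obtain c where c: "c > 0" "\<And>x. q \<tau> x = c * (p (t 1) x * exp (r \<tau> x))"
    using \<open>q \<tau> \<propto> _\<close> by (auto simp: proportional_def)
  obtain c' where c': "c' > 0" "\<And>x. q \<tau>' x = c' * (p (t N) x * exp (r \<tau>' x))"
    using \<open>q \<tau>' \<propto> _\<close> by (auto simp: proportional_def)
  have ppos: "p (t n) x > 0" if "n \<in> {1..N}" for n x
    using assms(7)[OF that] by (simp add: pos_density_def)
  \<comment> \<open>The numerator simplifies because overwriting coordinate 1 of \<open>X\<close> by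
    its own value \<open>X 1\<close> gives back \<open>X\<close>.\<close>
  have posterior: "posterior_density N (p (t N)) p_nu X (X 1)
      = p (t N) (X N) * (\<Prod>n=1..<N. p_nu n (X n) (X (Suc n))) / p (t 1) (X 1)" for X
    unfolding posterior_density_def
    using integral_path_density[of N p_nu "\<lambda>n. p (t n)"] assms by (simp add: path_density_def)
  show ?thesis
    unfolding proportional_def
  \<comment> \<open>The constant is the ratio of the normalising constants of
    \<open>q \<tau>\<close> and \<open>q \<tau>'\<close>, hence independent of the path.\<close>
  proof (intro exI[of _ "c / c'"] conjI allI)
    fix X :: "nat \<Rightarrow> real ^ 'd"
    show "importance_weight (\<lambda>X. q \<tau> (X 1) * posterior_density N (p (t N)) p_nu X (X 1))
        (path_density N (q \<tau>') p_a) X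
      = c / c' * (exp (r \<tau> (X 1)) / exp (r \<tau>' (X N)) *
          ((\<Prod>n=1..<N. p_nu n (X n) (X (Suc n))) / (\<Prod>n=1..<N. p_a n (X n) (X (Suc n)))))"
      \<comment> \<open>The two marginals cancel because they are nonzero at the endpoints of the
        path.\<close>
      using ppos[of 1 "X 1"] ppos[of N "X N"] \<open>N \<ge> 2\<close>
      unfolding importance_weight_def posterior c c' path_density_def by simp
  qed (use c c' in simp)
qed

end
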